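(* For each Darboux butterfly in the Euclidean plane, there is a unique ellipse such that the butterfly is a $4$-periodic billiard trajectory within that ellipse.
   Context: A Darboux butterfly is a closed self-intersecting polygonal line $ABCD$ (with sides $AB$, $BC$, $CD$, $DA$) such that $AB\cong CD$ and $AD\cong BC$; it is understood to be nondegenerate (four distinct vertices, not all on one line). A billiard trajectory within an ellipse $\mathcal{E}$ is a polygonal line with all vertices on $\mathcal{E}$ such that any two consecutive sides satisfy the billiard reflection law at their common vertex: they form congruent angles with the tangent line to $\mathcal{E}$ at that vertex (equivalently, the tangent line is the bisector of the exterior angle formed by the two sides). A closed polygonal line with four vertices is a $4$-periodic billiard trajectory within $\mathcal{E}$ if its vertices lie on $\mathcal{E}$ and the reflection law holds at each of its four vertices. Circles are regarded as ellipses. *)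

theory Defs
  imports "HOL-Analysis.Analysis"
begin

type_synonym point = "real ^ 2"

text \<open>Overlapping adjacent sides need no separate clause: together with the two congruences below,
  three collinear consecutive vertices would force all four vertices to be collinear.\<close>

definition self_intersecting_quad :: "point \<Rightarrow> point \<Rightarrow> point \<Rightarrow> point \<Rightarrow> bool" where
  "self_intersecting_quad A B C D \<longleftrightarrow>
     closed_segment A B \<inter> closed_segment C D \<noteq> {} \<or>
     closed_segment B C \<inter> closed_segment D A \<noteq> {}"

definition darboux_butterfly :: "point \<Rightarrow> point \<Rightarrow> point \<Rightarrow> point \<Rightarrow> bool" where
  "darboux_butterfly A B C D \<longleftrightarrow>
     distinct [A, B, C, D] \<and> \<not> collinear {A, B, C, D} \<and>
     self_intersecting_quad A B C D \<and>
     dist A B = dist C D \<and> dist A D = dist B C"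

text \<open>An ellipse is a set of points (the curve, not the enclosed region) given by the canonical
  equation in some orthonormal frame \<open>u, v\<close> with origin \<open>c\<close>; \<open>a = b\<close> is a circle.\<close>

definition is_ellipse :: "point set \<Rightarrow> bool" where
  "is_ellipse E \<longleftrightarrow>
     (\<exists>c u v a b. norm u = 1 \<and> norm v = 1 \<and> u \<bullet> v = 0 \<and> 0 < a \<and> 0 < b \<and>
        E = {c + x *\<^sub>R u + y *\<^sub>R v | x y. x\<^sup>2 / a\<^sup>2 + y\<^sup>2 / b\<^sup>2 = 1})"

text \<open>The tangent line to \<open>E\<close> at \<open>P\<close> is represented by its nonzero direction vectors: velocities
  at \<open>P\<close> of curves that run in \<open>E\<close>.\<close>

definition tangent_direction :: "point set \<Rightarrow> point \<Rightarrow> point \<Rightarrow> bool" where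
  "tangent_direction E P w \<longleftrightarrow>
     w \<noteq> 0 \<and>
     (\<exists>\<gamma> :: real \<Rightarrow> point. (\<forall>t. \<gamma> t \<in> E) \<and> \<gamma> 0 = P \<and> (\<gamma> has_vector_derivative w) (at 0))"

text \<open>The angle in \<open>[0, pi/2]\<close> between the lines spanned by two nonzero vectors.\<close>

definition line_angle :: "point \<Rightarrow> point \<Rightarrow> real" where
  "line_angle x y = arccos (\<bar>x \<bullet> y\<bar> / (norm x * norm y))"

text \<open>The sides \<open>PX\<close> and \<open>PY\<close> form congruent angles with the tangent line at \<open>P\<close>. When
  \<open>P, X, Y\<close> are distinct points of an ellipse \<open>E\<close>, both \<open>X\<close> and \<open>Y\<close> lie strictly on the same
  side of the tangent and \<open>P, X, Y\<close> are not collinear, so the tangent is then the bisector of the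
  exterior angle at \<open>P\<close>; it cannot be the bisector of the interior angle.\<close>

definition reflection_law :: "point set \<Rightarrow> point \<Rightarrow> point \<Rightarrow> point \<Rightarrow> bool" where
  "reflection_law E X P Y \<longleftrightarrow>
     (\<exists>w. tangent_direction E P w \<and> line_angle w (X - P) = line_angle w (Y - P))"

definition four_periodic_billiard :: "point set \<Rightarrow> point \<Rightarrow> point \<Rightarrow> point \<Rightarrow> point \<Rightarrow> bool" where
  "four_periodic_billiard E A B C D \<longleftrightarrow>
     {A, B, C, D} \<subseteq> E \<and>
     reflection_law E D A B \<and> reflection_law E A B C \<and>
     reflection_law E B C D \<and> reflection_law E C D A"

end

theory Submission
  imports Defs
begin

text \<open>If \<open>P\<close> and \<open>P + z\<close> lie on the ellipse \<open>Q (X - c) = 1\<close> with normal \<open>n\<close> at \<open>P\<close>, then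
  \<open>n \<bullet> z = - Q z / 2\<close>. Hence the reflection law at \<open>P\<close> for the chords \<open>z\<close>, \<open>z'\<close> says
  \<open>Q z / |z| = Q z' / |z'|\<close>, a condition on \<open>Q\<close> alone that is symmetric in the two ends of a chord.
  A Darboux butterfly is an antiparallelogram: \<open>A, C\<close> and \<open>B, D\<close> are exchanged by the
  reflection in a line. In coordinates adapted to that axis, \<open>A, C = (\<plusminus>p, 0)\<close> and
  \<open>B, D = (\<plusminus>q, h)\<close>, the four reflection laws say that \<open>Q\<close> is diagonal and fix the ratio of its
  two coefficients; that the curve passes through the vertices fixes the centre and the scale.\<close>

section \<open>Orthonormal frames and angles in the plane\<close>

lemma orthonormal_expand:
  fixes u v z :: point
  assumes "norm u = 1" "norm v = 1" "u \<bullet> v = 0"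
  shows "z = (z \<bullet> u) *\<^sub>R u + (z \<bullet> v) *\<^sub>R v"
proof -
  have u: "u$1 * u$1 + u$2 * u$2 = 1" and v: "v$1 * v$1 + v$2 * v$2 = 1"
    and uv: "u$1 * v$1 + u$2 * v$2 = 0"
    using assms by (simp_all add: norm_eq_1 inner_vec_def sum_2)
  have "z$1 = (z$1 * u$1 + z$2 * u$2) * u$1 + (z$1 * v$1 + z$2 * v$2) * v$1"
       "z$2 = (z$1 * u$1 + z$2 * u$2) * u$2 + (z$1 * v$1 + z$2 * v$2) * v$2"
    using u v uv by algebra+
  then show ?thesis
    by (simp add: vec_eq_iff forall_2 inner_vec_def sum_2)
qed

lemma orthonormal_norm_sq:
  fixes u v z :: point
  assumes "norm u = 1" "norm v = 1" "u \<bullet> v = 0"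
  shows "(norm z)\<^sup>2 = (z \<bullet> u)\<^sup>2 + (z \<bullet> v)\<^sup>2"
proof -
  have "(norm z)\<^sup>2 = z \<bullet> ((z \<bullet> u) *\<^sub>R u + (z \<bullet> v) *\<^sub>R v)"
    using orthonormal_expand[OF assms] by (simp add: power2_norm_eq_inner)
  then show ?thesis by (simp add: inner_add_right power2_eq_square)
qed

text \<open>Pythagoras in the frame spanned by \<open>n\<close> and \<open>w\<close>, with
  denominators cleared. With \<open>n\<close> normal and \<open>w\<close> tangent to an ellipse, it
  trades angles with the tangent for angles with the normal.\<close>

lemma orthogonal_norm_sq:
  fixes n w z :: point
  assumes "n \<noteq> 0" "w \<noteq> 0" "n \<bullet> w = 0"
  shows "(n \<bullet> n) * (w \<bullet> w) * (z \<bullet> z) = (w \<bullet> w) * (n \<bullet> z)\<^sup>2 + (n \<bullet> n) * (w \<bullet> z)\<^sup>2"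
proof -
  have "(norm z)\<^sup>2 = (z \<bullet> (n /\<^sub>R norm n))\<^sup>2 + (z \<bullet> (w /\<^sub>R norm w))\<^sup>2"
    using assms by (intro orthonormal_norm_sq) auto
  also have "\<dots> = (n \<bullet> z)\<^sup>2 / (n \<bullet> n) + (w \<bullet> z)\<^sup>2 / (w \<bullet> w)"
    by (simp add: power_mult_distrib power_inverse power2_norm_eq_inner inner_commute
        divide_inverse mult.commute)
  finally show ?thesis
    using assms by (simp add: power2_norm_eq_inner field_simps)
qed

text \<open>\<open>arccos\<close> is injective on [-1, 1], where Cauchy-Schwarz puts both quotients;
  both sides being nonnegative, squaring loses nothing and removes the absolute values and
  norms.\<close>

lemma line_angle_eq_iff:
  assumes "w \<noteq> 0" "x \<noteq> 0" "y \<noteq> 0"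
  shows "line_angle w x = line_angle w y \<longleftrightarrow> (w \<bullet> x)\<^sup>2 * (y \<bullet> y) = (w \<bullet> y)\<^sup>2 * (x \<bullet> x)"
proof -
  have *: "\<bar>\<bar>w \<bullet> z\<bar> / (norm w * norm z)\<bar> \<le> 1" if "z \<noteq> 0" for z
    using that assms(1) Cauchy_Schwarz_ineq2[of w z] by (simp add: divide_le_eq)
  have "line_angle w x = line_angle w y \<longleftrightarrow>
      \<bar>w \<bullet> x\<bar> / (norm w * norm x) = \<bar>w \<bullet> y\<bar> / (norm w * norm y)"
    unfolding line_angle_def by (rule arccos_eq_iff) (use * assms in auto)
  also have "\<dots> \<longleftrightarrow> \<bar>w \<bullet> x\<bar> * norm y = \<bar>w \<bullet> y\<bar> * norm x"
    using assms by (simp add: field_simps)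
  also have "\<dots> \<longleftrightarrow> (\<bar>w \<bullet> x\<bar> * norm y)\<^sup>2 = (\<bar>w \<bullet> y\<bar> * norm x)\<^sup>2"
    by (simp add: power2_eq_iff_nonneg)
  finally show ?thesis
    by (simp add: power_mult_distrib power2_norm_eq_inner)
qed

section \<open>Reflection law of an ellipse in terms of its quadratic form\<close>

locale ellipse_frame =
  fixes c u v :: point and a b :: real
  assumes unit_u: "norm u = 1" and unit_v: "norm v = 1" and orth: "u \<bullet> v = 0"
    and a_pos: "0 < a" and b_pos: "0 < b"
begin

text \<open>The polar form of the quadratic form Q of the ellipse. It acts on difference vectors and
  is independent of the centre \<open>c\<close>.\<close>

definition form :: "point \<Rightarrow> point \<Rightarrow> real" where
  "form z w = (z \<bullet> u) * (w \<bullet> u) / a\<^sup>2 + (z \<bullet> v) * (w \<bullet> v) / b\<^sup>2"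

definition curve :: "point set" where
  "curve = {c + x *\<^sub>R u + y *\<^sub>R v | x y. x\<^sup>2 / a\<^sup>2 + y\<^sup>2 / b\<^sup>2 = 1}"

text \<open>Half the gradient at \<open>P\<close> of the function whose level set 1 is the
  ellipse.\<close>

definition normal_at :: "point \<Rightarrow> point" where
  "normal_at P = (((P - c) \<bullet> u) / a\<^sup>2) *\<^sub>R u + (((P - c) \<bullet> v) / b\<^sup>2) *\<^sub>R v"

lemma is_ellipse_curve: "is_ellipse curve"
  unfolding is_ellipse_def curve_def
  using unit_u unit_v orth a_pos b_pos by blast

lemma inner_uv: "u \<bullet> u = 1" "v \<bullet> v = 1" "u \<bullet> v = 0" "v \<bullet> u = 0"
  using unit_u unit_v orth by (simp_all add: norm_eq_1 inner_commute)

lemma mem_curve: "X \<in> curve \<longleftrightarrow> form (X - c) (X - c) = 1"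
proof
  assume "X \<in> curve"
  then show "form (X - c) (X - c) = 1"
    unfolding curve_def form_def
    by (auto simp: inner_add_left inner_uv power2_eq_square)
next
  assume 1: "form (X - c) (X - c) = 1"
  have "X = c + ((X - c) \<bullet> u) *\<^sub>R u + ((X - c) \<bullet> v) *\<^sub>R v"
    using orthonormal_expand[OF unit_u unit_v orth, of "X - c"]
    by (metis add.assoc add_diff_cancel_left' diff_add_cancel add.commute)
  with 1 show "X \<in> curve"
    unfolding curve_def form_def power2_eq_square by blast
qed

lemma form_add_left: "form (x + y) z = form x z + form y z"
  and form_add_right: "form z (x + y) = form z x + form z y"
  and form_scale_left: "form (r *\<^sub>R x) z = r * form x z"
  and form_scale_right: "form z (r *\<^sub>R x) = r * form z x"
  by (simp_all add: form_def inner_simps algebra_simps add_divide_distrib)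

lemma form_commute: "form x y = form y x"
  by (simp add: form_def mult.commute)

lemmas form_simps = form_add_left form_add_right form_scale_left form_scale_right

lemma form_pos: "z \<noteq> 0 \<Longrightarrow> form z z > 0"
proof -
  assume "z \<noteq> 0"
  then have "z \<bullet> u \<noteq> 0 \<or> z \<bullet> v \<noteq> 0"
    using orthonormal_expand[OF unit_u unit_v orth, of z] by auto
  then have "(z \<bullet> u)\<^sup>2 / a\<^sup>2 + (z \<bullet> v)\<^sup>2 / b\<^sup>2 > 0"
    using a_pos b_pos by (auto intro: add_pos_nonneg add_nonneg_pos)
  then show ?thesis by (simp add: form_def power2_eq_square)
qed

lemma inner_normal: "normal_at P \<bullet> z = form (P - c) z"
  by (simp add: normal_at_def form_def inner_add_left inner_commute[of u z] inner_commute[of v z])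

lemma normal_nonzero: "P \<in> curve \<Longrightarrow> normal_at P \<noteq> 0"
  using inner_normal[of P "P - c"] by (auto simp: mem_curve)

text \<open>Along a path in the ellipse the quadratic form keeps the value 1, so its derivative
  \<open>2 * form (P - c) w\<close> vanishes.\<close>

lemma tangent_normal:
  assumes "tangent_direction curve P w"
  shows "normal_at P \<bullet> w = 0"
proof -
  obtain \<gamma> where mem: "\<And>t. \<gamma> t \<in> curve" and P: "\<gamma> 0 = P"
    and d: "(\<gamma> has_vector_derivative w) (at 0)"
    using assms unfolding tangent_direction_def by blast
  have i: "((\<lambda>t. (\<gamma> t - c) \<bullet> e) has_real_derivative w \<bullet> e) (at 0)" for e
  proof -
    have "((\<lambda>t. (\<gamma> t - c) \<bullet> e) has_vector_derivative (w - 0) \<bullet> e) (at 0)"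
      by (rule bounded_linear.has_vector_derivative[OF bounded_linear_inner_left])
        (intro has_vector_derivative_diff d has_vector_derivative_const)
    then show ?thesis by (simp add: has_real_derivative_iff_has_vector_derivative)
  qed
  have "((\<lambda>t. form (\<gamma> t - c) (\<gamma> t - c)) has_real_derivative 2 * form (P - c) w) (at 0)"
    unfolding form_def
    by (rule DERIV_cong[OF DERIV_add[OF DERIV_cdivide[OF DERIV_mult[OF i i]] DERIV_cdivide[OF DERIV_mult[OF i i]]]])
      (simp add: P algebra_simps add_divide_distrib)
  moreover have "(\<lambda>t. form (\<gamma> t - c) (\<gamma> t - c)) = (\<lambda>t. 1)"
    using mem by (simp add: mem_curve)
  ultimately have "((\<lambda>t. 1) has_real_derivative 2 * form (P - c) w) (at 0)"
    by simp
  then have "2 * form (P - c) w = 0"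
    using DERIV_unique DERIV_const by blast
  then show ?thesis by (simp add: inner_normal)
qed

text \<open>The reflection law asks for some tangent direction, so a condition shown equivalent to
  it for each direction yields the law only once a direction exists.\<close>

lemma tangent_exists:
  assumes "P \<in> curve"
  shows "\<exists>w. tangent_direction curve P w"
proof -
  obtain x y where P: "P = c + x *\<^sub>R u + y *\<^sub>R v" and xy: "x\<^sup>2 / a\<^sup>2 + y\<^sup>2 / b\<^sup>2 = 1"
    using assms unfolding curve_def by blast
  have "(x / a)\<^sup>2 + (y / b)\<^sup>2 = 1" using xy by (simp add: power_divide)
  then obtain s where s: "x / a = cos s" "y / b = sin s"
    using sincos_total_2pi by metis
  \<comment> \<open>The parametrization by the eccentric angle, shifted to pass through
    \<open>P\<close> at time 0; \<open>w\<close> is its velocity there.\<close>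
  define \<gamma> where "\<gamma> t = c + (a * cos (s + t)) *\<^sub>R u + (b * sin (s + t)) *\<^sub>R v" for t
  define w where "w = (- a * sin s) *\<^sub>R u + (b * cos s) *\<^sub>R v"
  have "\<gamma> t \<in> curve" for t
  proof -
    have "(a * cos (s + t))\<^sup>2 / a\<^sup>2 + (b * sin (s + t))\<^sup>2 / b\<^sup>2 = 1"
      using a_pos b_pos sin_cos_squared_add2[of "s + t"] by (simp add: power_mult_distrib)
    then show ?thesis unfolding curve_def \<gamma>_def by blast
  qed
  moreover have "\<gamma> 0 = P"
    using s a_pos b_pos by (auto simp: \<gamma>_def P field_simps)
  moreover have "(\<gamma> has_vector_derivative w) (at 0)"
    unfolding \<gamma>_def w_def
    by (auto intro!: derivative_eq_intros simp: has_real_derivative_iff_has_vector_derivative[symmetric] mult.commute)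
  moreover have "w \<noteq> 0"
  proof
    assume "w = 0"
    then have "w \<bullet> u = 0" "w \<bullet> v = 0" by auto
    then have "sin s = 0" "cos s = 0"
      using a_pos b_pos by (simp_all add: w_def inner_add_left inner_diff_left inner_uv)
    then show False using sin_cos_squared_add[of s] by simp
  qed
  ultimately show ?thesis unfolding tangent_direction_def by blast
qed

text \<open>Expanding Q at \<open>X - c\<close> = \<open>(P - c) + (X - P)\<close>, the values 1 at
  both ends cancel and leave
  \<open>2 * form (P - c) (X - P) + form (X - P) (X - P) = 0\<close>.\<close>

lemma chord_normal:
  assumes "P \<in> curve" "X \<in> curve"
  shows "normal_at P \<bullet> (X - P) = - form (X - P) (X - P) / 2"
proof -
  have "form (x + y) (x + y) = form x x + 2 * form x y + form y y" for x y
    by (simp add: form_simps form_commute[of y x])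
  from this[of "P - c" "X - P"] have "form (X - c) (X - c) =
      form (P - c) (P - c) + 2 * form (P - c) (X - P) + form (X - P) (X - P)"
    by simp
  with assms show ?thesis by (simp add: mem_curve inner_normal)
qed

text \<open>Equal angles with the tangent amount to equal angles with the normal, and
  \<open>chord_normal\<close> expresses the normal components of the chords by Q. The right-hand
  side no longer mentions the tangent, the normal or the centre.\<close>

lemma reflection_law_iff:
  assumes "P \<in> curve" "X \<in> curve" "Y \<in> curve" "X \<noteq> P" "Y \<noteq> P"
  shows "reflection_law curve X P Y \<longleftrightarrow>
    form (X - P) (X - P) * dist Y P = form (Y - P) (Y - P) * dist X P"
proof -
  let ?n = "normal_at P"
  have "line_angle w (X - P) = line_angle w (Y - P) \<longleftrightarrow>
      form (X - P) (X - P) * dist Y P = form (Y - P) (Y - P) * dist X P"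
    if w: "tangent_direction curve P w" for w
  proof -
    have w0: "w \<noteq> 0" using w by (simp add: tangent_direction_def)
    note pyth = orthogonal_norm_sq[OF normal_nonzero[OF assms(1)] w0 tangent_normal[OF w]]
    have nn: "?n \<bullet> ?n > 0" "w \<bullet> w > 0" using normal_nonzero[OF assms(1)] w0 by auto
    \<comment> \<open>Multiplying each instance of \<open>pyth\<close> by the squared length of the
      other chord and subtracting eliminates the product of the two squared lengths.\<close>
    have "(?n \<bullet> ?n) * ((w \<bullet> (X - P))\<^sup>2 * ((Y - P) \<bullet> (Y - P)) - (w \<bullet> (Y - P))\<^sup>2 * ((X - P) \<bullet> (X - P)))
      = - (w \<bullet> w) * ((?n \<bullet> (X - P))\<^sup>2 * ((Y - P) \<bullet> (Y - P)) - (?n \<bullet> (Y - P))\<^sup>2 * ((X - P) \<bullet> (X - P)))"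
      using pyth[of "X - P"] pyth[of "Y - P"] by algebra
    then have "(w \<bullet> (X - P))\<^sup>2 * ((Y - P) \<bullet> (Y - P)) = (w \<bullet> (Y - P))\<^sup>2 * ((X - P) \<bullet> (X - P))
      \<longleftrightarrow> (?n \<bullet> (X - P))\<^sup>2 * ((Y - P) \<bullet> (Y - P)) = (?n \<bullet> (Y - P))\<^sup>2 * ((X - P) \<bullet> (X - P))"
      using nn by (metis eq_iff_diff_eq_0 less_irrefl mult_eq_0_iff neg_equal_0_iff_equal)
    also have "\<dots> \<longleftrightarrow> (form (X - P) (X - P) * dist Y P)\<^sup>2 = (form (Y - P) (Y - P) * dist X P)\<^sup>2"
      unfolding chord_normal[OF assms(1,2)] chord_normal[OF assms(1,3)]
      by (simp add: power_mult_distrib power_divide dist_norm power2_norm_eq_inner)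
    also have "\<dots> \<longleftrightarrow> form (X - P) (X - P) * dist Y P = form (Y - P) (Y - P) * dist X P"
      using form_pos[of "X - P"] form_pos[of "Y - P"] assms
      by (intro power2_eq_iff_nonneg) auto
    finally show ?thesis
      using line_angle_eq_iff[OF w0, of "X - P" "Y - P"] assms by simp
  qed
  then show ?thesis
    unfolding reflection_law_def using tangent_exists[OF assms(1)] by blast
qed

end

text \<open>The predicate \<open>ellipse_frame\<close> does not take \<open>c\<close>, on which the
  locale puts no assumption, whereas \<open>curve\<close> depends on it.\<close>

lemma is_ellipse_obtain:
  assumes "is_ellipse E"
  obtains c u v a b where "ellipse_frame u v a b" "E = ellipse_frame.curve c u v a b"
proof -
  obtain c u v a b where *: "norm u = 1" "norm v = 1" "u \<bullet> v = 0" "0 < a" "0 < b"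
    and E: "E = {c + x *\<^sub>R u + y *\<^sub>R v | x y. x\<^sup>2 / a\<^sup>2 + y\<^sup>2 / b\<^sup>2 = 1}"
    using assms unfolding is_ellipse_def by blast
  then interpret ellipse_frame c u v a b by unfold_locales
  show thesis by (rule that) (use E curve_def ellipse_frame_axioms in auto)
qed

section \<open>From butterflies to antiparallelograms\<close>

text \<open>Opposite sides are exchanged by the point reflection in the centre \<open>m\<close>. A
  common point makes the half-diagonals \<open>x\<close> and \<open>y\<close> linearly
  dependent.\<close>

lemma crossed_parallelogram_collinear:
  fixes A B C D :: "'a :: euclidean_space"
  assumes par: "A + C = B + D" and meet: "closed_segment A B \<inter> closed_segment C D \<noteq> {}"
  shows "collinear {A, B, C, D}"
proof -
  define m where "m = (1/2) *\<^sub>R (A + C)"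
  define x y where "x = A - m" and "y = B - m"
  have "C = 2 *\<^sub>R m - A" by (simp add: m_def)
  moreover have "D = 2 *\<^sub>R m - B" using par by (simp add: m_def algebra_simps)
  ultimately have pts: "A = m + x" "B = m + y" "C = m - x" "D = m - y"
    by (simp_all add: x_def y_def algebra_simps scaleR_2)
  obtain s t where st: "0 \<le> s" "s \<le> 1" "0 \<le> t" "t \<le> 1"
    and eq: "(1 - s) *\<^sub>R A + s *\<^sub>R B = (1 - t) *\<^sub>R C + t *\<^sub>R D"
    using meet unfolding closed_segment_def by auto
  \<comment> \<open>The two coefficients add up to 2, so the relation is nontrivial.\<close>
  have lin: "(2 - s - t) *\<^sub>R x + (s + t) *\<^sub>R y = 0"
    using eq unfolding pts by (simp add: algebra_simps scaleR_2)
  have "\<exists>e f g. x = f *\<^sub>R e \<and> y = g *\<^sub>R e"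
  proof (cases "s + t = 0")
    case True
    then have "x = 0" using lin by (simp add: diff_diff_eq)
    then have "x = 0 *\<^sub>R y \<and> y = 1 *\<^sub>R y" by simp
    then show ?thesis by blast
  next
    case False
    have "(s + t) *\<^sub>R y = (- (2 - s - t)) *\<^sub>R x"
      using lin by (simp add: add_eq_0_iff algebra_simps)
    then have "y = (- (2 - s - t) / (s + t)) *\<^sub>R x"
      using False by (metis (no_types) eq_vector_fraction_iff)
    then have "x = 1 *\<^sub>R x \<and> y = (- (2 - s - t) / (s + t)) *\<^sub>R x" by simp
    then show ?thesis by blast
  qed
  then obtain e f g where "x = f *\<^sub>R e" "y = g *\<^sub>R e" by blast
  then have "A = m + f *\<^sub>R e" "B = m + g *\<^sub>R e" "C = m + (- f) *\<^sub>R e" "D = m + (- g) *\<^sub>R e"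
    by (simp_all add: pts)
  then show ?thesis unfolding collinear_alt by blast
qed

text \<open>The mirror axis runs through \<open>m\<close> in direction \<open>f\<close>. The signs
  of \<open>p\<close> and \<open>q\<close> are left free: opposite signs make AB and CD cross, equal
  signs BC and DA.\<close>

locale antiparallelogram =
  fixes m e f :: point and p q h :: real and A B C D :: point
  assumes unit_e: "norm e = 1" and unit_f: "norm f = 1" and orth_ef: "e \<bullet> f = 0"
    and nz: "p \<noteq> 0" "q \<noteq> 0" "h \<noteq> 0"
    and pts: "A = m + p *\<^sub>R e" "B = m + q *\<^sub>R e + h *\<^sub>R f"
      "C = m - p *\<^sub>R e" "D = m - q *\<^sub>R e + h *\<^sub>R f"

text \<open>The two congruences make the vector \<open>d\<close> between the midpoints of the
  diagonals orthogonal to both diagonals. Once \<open>d\<close> is nonzero, the diagonals are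
  parallel and \<open>d\<close> gives the mirror axis.\<close>

lemma darboux_butterfly_antiparallelogram:
  assumes "darboux_butterfly A B C D"
  obtains m e f p q h where "antiparallelogram m e f p q h A B C D"
proof -
  have dis: "A \<noteq> C" "B \<noteq> D" and ncol: "\<not> collinear {A, B, C, D}"
    and si: "self_intersecting_quad A B C D"
    and eq1: "dist A B = dist C D" and eq2: "dist A D = dist B C"
    using assms unfolding darboux_butterfly_def by auto
  define m where "m = (1/2) *\<^sub>R (A + C)"
  define M where "M = (1/2) *\<^sub>R (B + D)"
  define x where "x = A - m"
  define y where "y = B - M"
  define d where "d = M - m"
  have "C = 2 *\<^sub>R m - A" by (simp add: m_def)
  moreover have "D = 2 *\<^sub>R M - B" by (simp add: M_def)
  ultimately have pts: "A = m + x" "C = m - x" "B = m + d + y" "D = m + d - y"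
    by (simp_all add: x_def y_def d_def algebra_simps scaleR_2)
  have x0: "x \<noteq> 0" and y0: "y \<noteq> 0" using dis by (auto simp: pts)
  have "(dist A B)\<^sup>2 = (dist C D)\<^sup>2" "(dist A D)\<^sup>2 = (dist B C)\<^sup>2" using eq1 eq2 by simp_all
  then have "d \<bullet> (y - x) = 0" "d \<bullet> (y + x) = 0"
    unfolding dist_norm power2_norm_eq_inner pts
    by (simp_all add: inner_simps inner_commute algebra_simps)
  then have dx: "d \<bullet> x = 0" and dy: "d \<bullet> y = 0" by (simp_all add: inner_simps)
  \<comment> \<open>Self-intersection enters here: with coinciding midpoints ABCD would be a
    parallelogram.\<close>
  have d0: "d \<noteq> 0"
  proof
    assume d: "d = 0"
    have "collinear {A, B, C, D}"
    proof (cases "closed_segment A B \<inter> closed_segment C D = {}")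
      case False
      then show ?thesis
        by (intro crossed_parallelogram_collinear) (simp_all add: pts d)
    next
      case True
      then have "closed_segment B C \<inter> closed_segment D A \<noteq> {}"
        using si unfolding self_intersecting_quad_def by blast
      then have "collinear {B, C, D, A}"
        by (intro crossed_parallelogram_collinear) (simp_all add: pts d)
      then show ?thesis by (simp add: insert_commute)
    qed
    with ncol show False by blast
  qed
  define e where "e = x /\<^sub>R norm x"
  define f where "f = d /\<^sub>R norm d"
  have on: "norm e = 1" "norm f = 1" "e \<bullet> f = 0"
    using x0 d0 dx by (simp_all add: e_def f_def inner_commute)
  have "y \<bullet> f = 0" using dy by (simp add: f_def inner_commute)
  \<comment> \<open>In the plane, orthogonality to \<open>f\<close> leaves only the direction of the
    other diagonal.\<close>
  then have y: "y = (y \<bullet> e) *\<^sub>R e" using orthonormal_expand[OF on, of y] by simp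
  then have "y \<bullet> e \<noteq> 0" using y0 by auto
  moreover have "x = norm x *\<^sub>R e" "d = norm d *\<^sub>R f" using x0 d0 by (simp_all add: e_def f_def)
  ultimately have "antiparallelogram m e f (norm x) (y \<bullet> e) (norm d) A B C D"
    using on x0 d0 y by unfold_locales (simp_all add: pts)
  then show thesis by (rule that)
qed

section \<open>The billiard ellipse of an antiparallelogram\<close>

context antiparallelogram
begin

definition sAB :: real where "sAB = dist A B"
definition sAD :: real where "sAD = dist A D"
text \<open>The reflection laws force the coefficients of Q along \<open>e\<close> and
  \<open>f\<close> into the ratio \<open>h\<^sup>2\<close> to \<open>r\<close>.\<close>

definition r :: real where "r = sAB * sAD + h\<^sup>2"
text \<open>The height of the centre above \<open>m\<close>: the solution of \<open>h\<^sup>2 *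
  p\<^sup>2 + r * k\<^sup>2 = h\<^sup>2 * q\<^sup>2 + r * (h - k)\<^sup>2\<close>, which puts
  \<open>A\<close> and \<open>B\<close> on the same level curve. \<open>N\<close> is that
  level.\<close>

definition k :: real where "k = (h * (q\<^sup>2 - p\<^sup>2) + h * r) / (2 * r)"
definition N :: real where "N = h\<^sup>2 * p\<^sup>2 + r * k\<^sup>2"

definition E0 :: "point set" where
  "E0 = {X. h\<^sup>2 * ((X - m) \<bullet> e)\<^sup>2 + r * ((X - m) \<bullet> f - k)\<^sup>2 = N}"

lemma inner_ef: "e \<bullet> e = 1" "f \<bullet> f = 1" "e \<bullet> f = 0" "f \<bullet> e = 0"
  using unit_e unit_f orth_ef by (simp_all add: norm_eq_1 inner_commute)

lemma norm_comb: "norm (x *\<^sub>R e + y *\<^sub>R f) = sqrt (x\<^sup>2 + y\<^sup>2)"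
  by (simp add: norm_eq_sqrt_inner inner_simps inner_ef power2_eq_square)

lemma sides:
  "B - A = (q - p) *\<^sub>R e + h *\<^sub>R f" "A - B = (p - q) *\<^sub>R e + (- h) *\<^sub>R f"
  "D - A = (- q - p) *\<^sub>R e + h *\<^sub>R f" "A - D = (p + q) *\<^sub>R e + (- h) *\<^sub>R f"
  "B - C = (q + p) *\<^sub>R e + h *\<^sub>R f" "C - B = (- p - q) *\<^sub>R e + (- h) *\<^sub>R f"
  "D - C = (p - q) *\<^sub>R e + h *\<^sub>R f" "C - D = (q - p) *\<^sub>R e + (- h) *\<^sub>R f"
  by (simp_all add: pts algebra_simps)

lemma sAB_eq: "sAB = sqrt ((q - p)\<^sup>2 + h\<^sup>2)"
  and sAD_eq: "sAD = sqrt ((q + p)\<^sup>2 + h\<^sup>2)"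
  unfolding sAB_def sAD_def dist_norm sides norm_comb
  by (simp_all add: power2_commute add.commute)

lemma sAB_sq: "sAB\<^sup>2 = (q - p)\<^sup>2 + h\<^sup>2" and sAD_sq: "sAD\<^sup>2 = (q + p)\<^sup>2 + h\<^sup>2"
  by (simp_all add: sAB_eq sAD_eq)

lemma dists: "dist A B = sAB" "dist B A = sAB" "dist C D = sAB" "dist D C = sAB"
  "dist A D = sAD" "dist D A = sAD" "dist B C = sAD" "dist C B = sAD"
  unfolding sAB_eq sAD_eq dist_norm sides norm_comb
  by (simp_all add: power2_eq_square algebra_simps)

lemma sAB_pos: "sAB > 0" and sAD_pos: "sAD > 0"
  using nz by (auto simp: sAB_eq sAD_eq intro!: add_nonneg_pos)

lemma sAB_neq_sAD: "sAB \<noteq> sAD"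
proof
  assume "sAB = sAD"
  then have "(q - p)\<^sup>2 = (q + p)\<^sup>2" using sAB_sq sAD_sq by simp
  then have "q * p = 0" by (simp add: power2_eq_square algebra_simps)
  with nz show False by simp
qed

lemma adjacent_distinct: "A \<noteq> B" "B \<noteq> C" "C \<noteq> D" "D \<noteq> A"
  using dists sAB_pos sAD_pos by (metis dist_self less_irrefl)+

lemma r_pos: "r > 0"
  using sAB_pos sAD_pos by (simp add: r_def add_pos_nonneg)

lemma N_pos: "N > 0"
  using nz r_pos by (simp add: N_def add_pos_nonneg)

text \<open>Clearing \<open>sAB\<close> and \<open>sAD\<close> from the reflection condition leaves the factor
  \<open>sAB - sAD\<close>, which does not vanish.\<close>

lemma ratio_iff:
  "(\<alpha> * (q - p)\<^sup>2 + \<beta> * h\<^sup>2) * sAD = (\<alpha> * (q + p)\<^sup>2 + \<beta> * h\<^sup>2) * sAB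
    \<longleftrightarrow> \<alpha> * r = \<beta> * h\<^sup>2"
proof -
  have "(\<alpha> * (q - p)\<^sup>2 + \<beta> * h\<^sup>2) * sAD - (\<alpha> * (q + p)\<^sup>2 + \<beta> * h\<^sup>2) * sAB
      = (sAB - sAD) * (\<alpha> * r - \<beta> * h\<^sup>2)"
    using sAB_sq sAD_sq unfolding r_def by algebra
  then show ?thesis using sAB_neq_sAD by auto
qed

lemma k_eq: "2 * r * k = h * (q\<^sup>2 - p\<^sup>2) + h * r"
  using r_pos by (simp add: k_def)

text \<open>Mirror images reverse the \<open>e\<close>-component, so opposite sides differ in Q only
  by the sign of the cross term. Comparing the laws at different vertices kills that term, and
  \<open>ratio_iff\<close> evaluates the single condition left.\<close>

lemma four_periodic_iff:
  fixes c :: point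
  assumes "ellipse_frame u v a b"
  defines "E \<equiv> ellipse_frame.curve c u v a b" and "g \<equiv> ellipse_frame.form u v a b"
  shows "four_periodic_billiard E A B C D \<longleftrightarrow> {A, B, C, D} \<subseteq> E \<and>
    g e f = 0 \<and> g e e * r = g f f * h\<^sup>2"
proof (cases "{A, B, C, D} \<subseteq> E")
  case False
  then show ?thesis unfolding four_periodic_billiard_def by blast
next
  case True
  interpret ellipse_frame c u v a b by fact
  have on: "A \<in> curve" "B \<in> curve" "C \<in> curve" "D \<in> curve" using True by (auto simp: E_def)
  have comb: "form (x *\<^sub>R e + y *\<^sub>R f) (x *\<^sub>R e + y *\<^sub>R f)
      = form e e * x\<^sup>2 + 2 * form e f * x * y + form f f * y\<^sup>2" for x y
    by (simp add: form_simps form_commute[of f e] power2_eq_square algebra_simps)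
  let ?P = "form e e * (q - p)\<^sup>2 + form f f * h\<^sup>2"
  let ?Q = "form e e * (q + p)\<^sup>2 + form f f * h\<^sup>2"
  let ?s = "2 * form e f * (q - p) * h" and ?t = "2 * form e f * (q + p) * h"
  have fs: "form (B - A) (B - A) = ?P + ?s" "form (A - B) (A - B) = ?P + ?s"
    "form (C - D) (C - D) = ?P - ?s" "form (D - C) (D - C) = ?P - ?s"
    "form (B - C) (B - C) = ?Q + ?t" "form (C - B) (C - B) = ?Q + ?t"
    "form (A - D) (A - D) = ?Q - ?t" "form (D - A) (D - A) = ?Q - ?t"
    unfolding sides comb by algebra+
  have "four_periodic_billiard curve A B C D \<longleftrightarrow>
      (?Q - ?t) * sAB = (?P + ?s) * sAD \<and> (?P + ?s) * sAD = (?Q + ?t) * sAB \<and>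
      (?Q + ?t) * sAB = (?P - ?s) * sAD \<and> (?P - ?s) * sAD = (?Q - ?t) * sAB"
    using on adjacent_distinct adjacent_distinct[symmetric]
    by (simp add: four_periodic_billiard_def reflection_law_iff dists fs)
  also have "\<dots> \<longleftrightarrow> ?s = 0 \<and> ?t = 0 \<and> ?P * sAD = ?Q * sAB"
  proof -
    have "(y - t) * sAB = (x + s) * sAD \<and> (x + s) * sAD = (y + t) * sAB \<and>
        (y + t) * sAB = (x - s) * sAD \<and> (x - s) * sAD = (y - t) * sAB
      \<longleftrightarrow> s = 0 \<and> t = 0 \<and> x * sAD = y * sAB" (is "?L \<longleftrightarrow> ?R") for x y s t
    proof
      assume ?L
      \<comment> \<open>Two equations with the same \<open>x\<close>-term give \<open>t\<close>, two
        with the same \<open>y\<close>-term give \<open>s\<close>.\<close>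
      then have "t * sAB = 0" "s * sAD = 0" by algebra+
      then have "t = 0" "s = 0" using sAB_pos sAD_pos by simp_all
      moreover have "(x + s) * sAD = (y + t) * sAB" using \<open>?L\<close> by blast
      ultimately show ?R by simp
    qed auto
    then show ?thesis .
  qed
  \<comment> \<open>\<open>q - p\<close> and \<open>q + p\<close> cannot both vanish, so one of the
    two cross terms already forces \<open>form e f = 0\<close>.\<close>
  also have "\<dots> \<longleftrightarrow> form e f = 0 \<and> form e e * r = form f f * h\<^sup>2"
    unfolding ratio_iff using nz by auto
  finally show ?thesis using True by (simp add: E_def g_def)
qed

text \<open>The reflection laws determine Q up to the factor \<open>s\<close>; incidence with the
  vertices then determines the centre, with coordinates \<open>c1\<close> and \<open>c2\<close>
  relative to \<open>m\<close>, and finally \<open>s\<close>.\<close>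

lemma billiard_ellipse_unique:
  assumes "is_ellipse E" "four_periodic_billiard E A B C D"
  shows "E = E0"
proof -
  obtain c u v a b where ef: "ellipse_frame u v a b" and E: "E = ellipse_frame.curve c u v a b"
    using is_ellipse_obtain[OF assms(1)] .
  interpret ellipse_frame c u v a b by fact
  have on: "A \<in> curve" "B \<in> curve" "C \<in> curve"
    and cross: "form e f = 0" and ratio: "form e e * r = form f f * h\<^sup>2"
    using assms(2) four_periodic_iff[OF ef, of c] by (auto simp: E)
  define s where "s = form f f / r"
  define c1 c2 where "c1 = (c - m) \<bullet> e" and "c2 = (c - m) \<bullet> f"
  have s_pos: "s > 0"
  proof -
    have "f \<noteq> 0" using unit_f by auto
    then show ?thesis using form_pos r_pos by (simp add: s_def)
  qed
  have ff: "form f f = s * r" and ee: "form e e = s * h\<^sup>2"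
    using ratio r_pos by (simp_all add: s_def field_simps)
  have mem: "X \<in> curve \<longleftrightarrow> s * (h\<^sup>2 * ((X - m) \<bullet> e - c1)\<^sup>2 + r * ((X - m) \<bullet> f - c2)\<^sup>2) = 1" for X
  proof -
    have "X - c = ((X - c) \<bullet> e) *\<^sub>R e + ((X - c) \<bullet> f) *\<^sub>R f"
      by (rule orthonormal_expand[OF unit_e unit_f orth_ef])
    moreover have "(X - c) \<bullet> e = (X - m) \<bullet> e - c1" "(X - c) \<bullet> f = (X - m) \<bullet> f - c2"
      by (simp_all add: c1_def c2_def inner_simps)
    ultimately have X: "X - c = ((X - m) \<bullet> e - c1) *\<^sub>R e + ((X - m) \<bullet> f - c2) *\<^sub>R f" by simp
    have "form (x *\<^sub>R e + y *\<^sub>R f) (x *\<^sub>R e + y *\<^sub>R f) = s * (h\<^sup>2 * x\<^sup>2 + r * y\<^sup>2)" for x y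
      by (simp add: form_simps form_commute[of f e] cross ee ff power2_eq_square algebra_simps)
    then show ?thesis by (simp only: mem_curve X)
  qed
  have A: "s * (h\<^sup>2 * (p - c1)\<^sup>2 + r * c2\<^sup>2) = 1"
    and B: "s * (h\<^sup>2 * (q - c1)\<^sup>2 + r * (h - c2)\<^sup>2) = 1"
    and C: "s * (h\<^sup>2 * (p + c1)\<^sup>2 + r * c2\<^sup>2) = 1"
    using on[unfolded mem] by (simp_all add: pts inner_simps inner_ef power2_eq_square algebra_simps)
  \<comment> \<open>Subtracting the equations at the mirror points \<open>A\<close> and
    \<open>C\<close> puts the centre on the axis.\<close>
  have "s * h\<^sup>2 * p * c1 = 0" using A C by algebra
  then have c1: "c1 = 0" using s_pos nz by simp
  \<comment> \<open>The difference of the equations at \<open>A\<close> and \<open>B\<close> is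
    linear in \<open>c2\<close>, and it is the equation that defines \<open>k\<close>.\<close>
  have "s * h * (2 * r * c2 - (h * (q\<^sup>2 - p\<^sup>2) + h * r)) = 0"
    using A B unfolding c1 by algebra
  then have "2 * r * c2 = 2 * r * k" using s_pos nz k_eq by simp
  then have c2: "c2 = k" using r_pos by simp
  have sN: "s * N = 1" using A by (simp add: c1 c2 N_def)
  have "X \<in> curve \<longleftrightarrow> X \<in> E0" for X
  proof -
    have "X \<in> curve \<longleftrightarrow> s * (h\<^sup>2 * ((X - m) \<bullet> e)\<^sup>2 + r * ((X - m) \<bullet> f - k)\<^sup>2) = s * N"
      unfolding mem c1 c2 sN by simp
    also have "\<dots> \<longleftrightarrow> X \<in> E0" using s_pos by (simp add: E0_def)
    finally show ?thesis .
  qed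
  then show ?thesis by (auto simp: E)
qed

lemma billiard_ellipse_exists: "is_ellipse E0 \<and> four_periodic_billiard E0 A B C D"
proof -
  \<comment> \<open>The semi-axes are read off from the equation of \<open>E0\<close> divided by
    \<open>N\<close>; the absolute value allows for either sign of \<open>h\<close>.\<close>
  define a b c where "a = sqrt N / \<bar>h\<bar>" and "b = sqrt (N / r)" and "c = m + k *\<^sub>R f"
  have ab: "0 < a" "0 < b" and sq: "a\<^sup>2 = N / h\<^sup>2" "b\<^sup>2 = N / r"
    using nz r_pos N_pos by (simp_all add: a_def b_def power_divide)
  interpret ellipse_frame c e f a b
    using unit_e unit_f orth_ef ab by unfold_locales
  have E: "curve = E0"
  proof -
    have "X \<in> curve \<longleftrightarrow> X \<in> E0" for X
    proof -
      have coord: "(X - c) \<bullet> e = (X - m) \<bullet> e" "(X - c) \<bullet> f = (X - m) \<bullet> f - k"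
        by (simp_all add: c_def inner_simps inner_ef)
      show ?thesis
        unfolding mem_curve form_def sq coord E0_def using N_pos
        by (simp add: power2_eq_square divide_simps mult.commute)
    qed
    then show ?thesis by blast
  qed
  \<comment> \<open>The choice of \<open>k\<close> puts \<open>B\<close> and \<open>D\<close> on the
    level \<open>N\<close> of \<open>A\<close> and \<open>C\<close>.\<close>
  have "h\<^sup>2 * q\<^sup>2 + r * (h - k)\<^sup>2 = N" using k_eq unfolding N_def by algebra
  moreover have "h\<^sup>2 * p\<^sup>2 + r * (0 - k)\<^sup>2 = N" by (simp add: N_def)
  moreover have "(A - m) \<bullet> e = p" "(B - m) \<bullet> e = q" "(C - m) \<bullet> e = - p" "(D - m) \<bullet> e = - q"
    "(A - m) \<bullet> f = 0" "(B - m) \<bullet> f = h" "(C - m) \<bullet> f = 0" "(D - m) \<bullet> f = h"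
    by (simp_all add: pts inner_simps inner_ef)
  ultimately have "{A, B, C, D} \<subseteq> E0"
    by (simp add: E0_def)
  moreover have "form e f = 0" "form e e * r = form f f * h\<^sup>2"
    using N_pos r_pos nz by (simp_all add: form_def inner_ef sq)
  ultimately have "four_periodic_billiard curve A B C D"
    using four_periodic_iff[OF ellipse_frame_axioms, of c] by (simp add: E)
  then show ?thesis using is_ellipse_curve by (simp add: E)
qed

end

theorem theorem7p8:
  fixes A B C D :: "real ^ 2"
  assumes "darboux_butterfly A B C D"
  shows "\<exists>!E. is_ellipse E \<and> four_periodic_billiard E A B C D"
proof -
  obtain m e f p q h where "antiparallelogram m e f p q h A B C D"
    using darboux_butterfly_antiparallelogram[OF assms] .
  then interpret antiparallelogram m e f p q h A B C D .
  show ?thesis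
    using billiard_ellipse_exists billiard_ellipse_unique by blast
qed

end
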